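(* Let $U$ be a set (universe), $E$ a set of parameters, $A,B,C\subseteq E$, and let $\mathcal{F}_\alpha$, $\mathcal{G}_\beta$, $\mathcal{H}_\delta$ be any three generalised intuitionistic fuzzy soft sets over $(U,E)$, with parameter domains $A,B,C$ respectively. Then: (i) $\mathcal{F}_\alpha\tilde{\cup}\mathcal{G}_\beta=\mathcal{G}_\beta\tilde{\cup}\mathcal{F}_\alpha$; (ii) $\mathcal{F}_\alpha\tilde{\cap}\mathcal{G}_\beta=\mathcal{G}_\beta\tilde{\cap}\mathcal{F}_\alpha$; (iii) $\mathcal{F}_\alpha\tilde{\cup}(\mathcal{G}_\beta\tilde{\cup}\mathcal{H}_\delta)=(\mathcal{F}_\alpha\tilde{\cup}\mathcal{G}_\beta)\tilde{\cup}\mathcal{H}_\delta$; (iv) $\mathcal{F}_\alpha\tilde{\cap}(\mathcal{G}_\beta\tilde{\cap}\mathcal{H}_\delta)=(\mathcal{F}_\alpha\tilde{\cap}\mathcal{G}_\beta)\tilde{\cap}\mathcal{H}_\delta$.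
   Context: Intuitionistic fuzzy sets: an intuitionistic fuzzy subset of $U$ is a pair of functions $\mu,\nu:U\to[0,1]$ (degrees of membership and non-membership) with $\mu(x)+\nu(x)\le 1$ for all $x\in U$; $IF^U$ is the collection of all of them. Operations: $\ast:[0,1]\times[0,1]\to[0,1]$ is a continuous $t$-norm (commutative, associative, continuous, $a\ast 1=a$ for all $a$, and $a\ast b\le c\ast d$ whenever $a\le c$, $b\le d$), and $\diamond:[0,1]\times[0,1]\to[0,1]$ is a continuous $t$-conorm (commutative, associative, continuous, $a\diamond 0=a$ for all $a$, and $a\diamond b\le c\diamond d$ whenever $a\le c$, $b\le d$). Generalised intuitionistic fuzzy soft set over $(U,E)$: given $A\subseteq E$, $\mathcal{F}:A\to IF^U$ and a fuzzy subset $\alpha:A\to[0,1]$, it is the function $\mathcal{F}_\alpha:A\to IF^U\times[0,1]$, $\mathcal{F}_\alpha(a)=(\mathcal{F}(a),\alpha(a))$, where $\mathcal{F}(a)=(\mu_{\mathcal{F}(a)},\nu_{\mathcal{F}(a)})$. For $\mathcal{F}_\alpha$ with domain $A$ and $\mathcal{G}_\beta$ with domain $B$: The intersection $\mathcal{F}_\alpha\tilde{\cap}\mathcal{G}_\beta$ is defined as the generalised intuitionistic fuzzy soft set $A\cap B\to IF^U\times[0,1]$ whose value at $e\in A\cap B$ has membership function $x\mapsto\mu_{\mathcal{F}(e)}(x)\ast\mu_{\mathcal{G}(e)}(x)$, non-membership function $x\mapsto\nu_{\mathcal{F}(e)}(x)\diamond\nu_{\mathcal{G}(e)}(x)$, and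 preference degree $\alpha(e)\ast\beta(e)$. The union $\mathcal{F}_\alpha\tilde{\cup}\mathcal{G}_\beta$ is defined as the generalised intuitionistic fuzzy soft set $A\cup B\to IF^U\times[0,1]$ whose value at $e$ is $\mathcal{F}_\alpha(e)$ if $e\in A\setminus B$, is $\mathcal{G}_\beta(e)$ if $e\in B\setminus A$, and if $e\in A\cap B$ has membership function $x\mapsto\mu_{\mathcal{F}(e)}(x)\diamond\mu_{\mathcal{G}(e)}(x)$, non-membership function $x\mapsto\nu_{\mathcal{F}(e)}(x)\ast\nu_{\mathcal{G}(e)}(x)$, and preference degree $\alpha(e)\diamond\beta(e)$. *)

theory Defs
  imports Complex_Main "HOL-Library.FuncSet"
begin

text \<open>Binary operations on the unit interval are represented by total functions on the reals;
  their values outside the unit square are irrelevant.\<close>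

definition cont_t_norm :: "(real \<Rightarrow> real \<Rightarrow> real) \<Rightarrow> bool" where
  "cont_t_norm t \<longleftrightarrow>
     (\<forall>a\<in>{0..1}. \<forall>b\<in>{0..1}. t a b \<in> {0..1}) \<and>
     (\<forall>a\<in>{0..1}. \<forall>b\<in>{0..1}. t a b = t b a) \<and>
     (\<forall>a\<in>{0..1}. \<forall>b\<in>{0..1}. \<forall>c\<in>{0..1}. t a (t b c) = t (t a b) c) \<and>
     continuous_on ({0..1} \<times> {0..1}) (\<lambda>(a, b). t a b) \<and>
     (\<forall>a\<in>{0..1}. t a 1 = a) \<and>
     (\<forall>a\<in>{0..1}. \<forall>b\<in>{0..1}. \<forall>c\<in>{0..1}. \<forall>d\<in>{0..1}.
        a \<le> c \<longrightarrow> b \<le> d \<longrightarrow> t a b \<le> t c d)"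

definition cont_t_conorm :: "(real \<Rightarrow> real \<Rightarrow> real) \<Rightarrow> bool" where
  "cont_t_conorm s \<longleftrightarrow>
     (\<forall>a\<in>{0..1}. \<forall>b\<in>{0..1}. s a b \<in> {0..1}) \<and>
     (\<forall>a\<in>{0..1}. \<forall>b\<in>{0..1}. s a b = s b a) \<and>
     (\<forall>a\<in>{0..1}. \<forall>b\<in>{0..1}. \<forall>c\<in>{0..1}. s a (s b c) = s (s a b) c) \<and>
     continuous_on ({0..1} \<times> {0..1}) (\<lambda>(a, b). s a b) \<and>
     (\<forall>a\<in>{0..1}. s a 0 = a) \<and>
     (\<forall>a\<in>{0..1}. \<forall>b\<in>{0..1}. \<forall>c\<in>{0..1}. \<forall>d\<in>{0..1}.
        a \<le> c \<longrightarrow> b \<le> d \<longrightarrow> s a b \<le> s c d)"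

text \<open>Functions on the universe \<open>U\<close> are extensional, so that HOL equality is equality of
  functions with domain \<open>U\<close>.\<close>

definition IF_sets :: "'u set \<Rightarrow> (('u \<Rightarrow> real) \<times> ('u \<Rightarrow> real)) set" where
  "IF_sets U = {(\<mu>, \<nu>). \<mu> \<in> U \<rightarrow>\<^sub>E {0..1} \<and> \<nu> \<in> U \<rightarrow>\<^sub>E {0..1} \<and> (\<forall>x\<in>U. \<mu> x + \<nu> x \<le> 1)}"

text \<open>A function with parameter domain \<open>A\<close> is a partial map whose \<open>dom\<close> is \<open>A\<close>; equality of maps
  therefore includes equality of the parameter domains.\<close>

type_synonym ('u, 'e) gif_map = "'e \<rightharpoonup> (('u \<Rightarrow> real) \<times> ('u \<Rightarrow> real)) \<times> real"

definition gif_soft_set :: "'u set \<Rightarrow> 'e set \<Rightarrow> 'e set \<Rightarrow> ('u, 'e) gif_map \<Rightarrow> bool" where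
  "gif_soft_set U E A \<Phi> \<longleftrightarrow> A \<subseteq> E \<and>
     (\<exists>F \<alpha>. F \<in> A \<rightarrow> IF_sets U \<and> \<alpha> \<in> A \<rightarrow> {0..1} \<and>
        \<Phi> = (\<lambda>a. if a \<in> A then Some (F a, \<alpha> a) else None))"

text \<open>For an arbitrary t-norm \<open>t\<close> and t-conorm \<open>s\<close>, the combined membership and non-membership
  degrees lie in the unit interval, but their sum may exceed 1 (take \<open>t = min\<close> and
  \<open>s a b = min 1 (a + b)\<close>, with all degrees equal to 1/2). Intersection and union are therefore
  defined by their formulas on maps, without a restriction on the sum of the resulting degrees.\<close>

definition gif_inter ::
  "(real \<Rightarrow> real \<Rightarrow> real) \<Rightarrow> (real \<Rightarrow> real \<Rightarrow> real) \<Rightarrow> 'u set \<Rightarrow>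
   ('u, 'e) gif_map \<Rightarrow> ('u, 'e) gif_map \<Rightarrow> ('u, 'e) gif_map" where
  "gif_inter t s U \<Phi> \<Psi> = (\<lambda>e.
     case (\<Phi> e, \<Psi> e) of
       (Some ((\<mu>, \<nu>), a), Some ((\<mu>', \<nu>'), b)) \<Rightarrow>
         Some ((\<lambda>x\<in>U. t (\<mu> x) (\<mu>' x), \<lambda>x\<in>U. s (\<nu> x) (\<nu>' x)), t a b)
     | _ \<Rightarrow> None)"

definition gif_union ::
  "(real \<Rightarrow> real \<Rightarrow> real) \<Rightarrow> (real \<Rightarrow> real \<Rightarrow> real) \<Rightarrow> 'u set \<Rightarrow>
   ('u, 'e) gif_map \<Rightarrow> ('u, 'e) gif_map \<Rightarrow> ('u, 'e) gif_map" where
  "gif_union t s U \<Phi> \<Psi> = (\<lambda>e.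
     case (\<Phi> e, \<Psi> e) of
       (None, None) \<Rightarrow> None
     | (Some p, None) \<Rightarrow> Some p
     | (None, Some q) \<Rightarrow> Some q
     | (Some ((\<mu>, \<nu>), a), Some ((\<mu>', \<nu>'), b)) \<Rightarrow>
         Some ((\<lambda>x\<in>U. s (\<mu> x) (\<mu>' x), \<lambda>x\<in>U. t (\<nu> x) (\<nu>' x)), s a b))"

end

theory Submission
  imports Defs
begin

text \<open>All four identities are checked parameter by parameter. At a parameter \<open>e\<close>,
  each given map is either defined or not, and in each case both sides are undefined, or copy the
  same value, or combine the same degrees in another order or bracketing. The last case is settled
  pointwise on \<open>U\<close>, and for the preference degree, by commutativity or associativity of
  \<open>t\<close> and \<open>s\<close>. These laws hold only on the unit interval, so
  \<open>gif_soft_set_unit\<close> supplies the range of every degree involved. It is applied only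
  to the given maps, never to a union or an intersection, where membership and non-membership may
  sum to more than 1.\<close>

lemma gif_soft_set_unit:
  assumes "gif_soft_set U E A \<Phi>" and "\<Phi> e = Some ((\<mu>, \<nu>), a)"
  shows "a \<in> {0..1}"
    and "x \<in> U \<Longrightarrow> \<mu> x \<in> {0..1}"
    and "x \<in> U \<Longrightarrow> \<nu> x \<in> {0..1}"
proof -
  obtain F \<alpha> where F: "F \<in> A \<rightarrow> IF_sets U" and \<alpha>: "\<alpha> \<in> A \<rightarrow> {0..1}"
    and \<Phi>: "\<Phi> = (\<lambda>a. if a \<in> A then Some (F a, \<alpha> a) else None)"
    using assms(1) unfolding gif_soft_set_def by blast
  \<comment> \<open>The map is \<open>None\<close> off \<open>A\<close>, so a defined value forces
    \<open>e\<close> into \<open>A\<close>, where \<open>F\<close> and \<open>\<alpha>\<close> are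
    controlled.\<close>
  have e: "e \<in> A" "F e = (\<mu>, \<nu>)" "\<alpha> e = a"
    using assms(2) by (auto simp: \<Phi> split: if_splits)
  show "a \<in> {0..1}"
    using \<alpha> e by blast
  have "(\<mu>, \<nu>) \<in> IF_sets U"
    using F e by (metis PiE Pi_mem)
  then show "x \<in> U \<Longrightarrow> \<mu> x \<in> {0..1}" "x \<in> U \<Longrightarrow> \<nu> x \<in> {0..1}"
    unfolding IF_sets_def by blast+
qed

text \<open>In this form the law serves as an introduction rule, leaving only range conditions to
  prove; the three laws below are used likewise.\<close>

lemma cont_t_norm_comm:
  "\<lbrakk>cont_t_norm t; a \<in> {0..1}; b \<in> {0..1}\<rbrakk> \<Longrightarrow> t a b = t b a"
  unfolding cont_t_norm_def by blast

lemma cont_t_norm_assoc: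
  "\<lbrakk>cont_t_norm t; a \<in> {0..1}; b \<in> {0..1}; c \<in> {0..1}\<rbrakk> \<Longrightarrow> t a (t b c) = t (t a b) c"
  unfolding cont_t_norm_def by blast

lemma cont_t_conorm_comm:
  "\<lbrakk>cont_t_conorm s; a \<in> {0..1}; b \<in> {0..1}\<rbrakk> \<Longrightarrow> s a b = s b a"
  unfolding cont_t_conorm_def by blast

lemma cont_t_conorm_assoc:
  "\<lbrakk>cont_t_conorm s; a \<in> {0..1}; b \<in> {0..1}; c \<in> {0..1}\<rbrakk> \<Longrightarrow> s a (s b c) = s (s a b) c"
  unfolding cont_t_conorm_def by blast

lemma gif_union_comm:
  assumes "cont_t_norm t" and "cont_t_conorm s"
    and "gif_soft_set U E A \<Phi>" and "gif_soft_set U E B \<Psi>"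
  shows "gif_union t s U \<Phi> \<Psi> = gif_union t s U \<Psi> \<Phi>"
proof
  fix e
  show "(gif_union t s U \<Phi> \<Psi>) e = (gif_union t s U \<Psi> \<Phi>) e"
    unfolding gif_union_def
    \<comment> \<open>If at most one map is defined at \<open>e\<close>, the two sides coincide by
      definition. If both are, \<open>restrict_ext\<close> reduces equality of the restricted
      functions to points of \<open>U\<close>, where the range facts hold.\<close>
    by (auto split: option.split prod.split intro!: restrict_ext
          cont_t_norm_comm[OF assms(1)]
          cont_t_conorm_comm[OF assms(2)]
        dest:
          gif_soft_set_unit[OF assms(3)]
          gif_soft_set_unit[OF assms(4)])
qed

lemma gif_inter_comm:
  assumes "cont_t_norm t" and "cont_t_conorm s"
    and "gif_soft_set U E A \<Phi>" and "gif_soft_set U E B \<Psi>"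
  shows "gif_inter t s U \<Phi> \<Psi> = gif_inter t s U \<Psi> \<Phi>"
proof
  fix e
  show "(gif_inter t s U \<Phi> \<Psi>) e = (gif_inter t s U \<Psi> \<Phi>) e"
    unfolding gif_inter_def
    by (auto split: option.split prod.split intro!: restrict_ext
          cont_t_norm_comm[OF assms(1)]
          cont_t_conorm_comm[OF assms(2)]
        dest:
          gif_soft_set_unit[OF assms(3)]
          gif_soft_set_unit[OF assms(4)])
qed

text \<open>An undefined value acts as a neutral element of the union, so the bracketing matters
  only where all three maps are defined. There the inner restricted function is evaluated at a point
  of \<open>U\<close>, which exposes a nested application of \<open>s\<close> or \<open>t\<close> to
  three degrees of the given maps.\<close>

lemma gif_union_assoc:
  assumes "cont_t_norm t" and "cont_t_conorm s"
    and "gif_soft_set U E A \<Phi>" and "gif_soft_set U E B \<Psi>" and "gif_soft_set U E C \<Theta>"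
  shows "gif_union t s U \<Phi> (gif_union t s U \<Psi> \<Theta>) = gif_union t s U (gif_union t s U \<Phi> \<Psi>) \<Theta>"
proof
  fix e
  show "(gif_union t s U \<Phi> (gif_union t s U \<Psi> \<Theta>)) e = (gif_union t s U (gif_union t s U \<Phi> \<Psi>) \<Theta>) e"
    unfolding gif_union_def
    by (auto split: option.split prod.split intro!: restrict_ext
          cont_t_norm_assoc[OF assms(1)]
          cont_t_conorm_assoc[OF assms(2)]
        dest:
          gif_soft_set_unit[OF assms(3)]
          gif_soft_set_unit[OF assms(4)]
          gif_soft_set_unit[OF assms(5)])
qed

text \<open>Here an undefined value is absorbing: both sides are \<open>None\<close> as soon as one
  map is undefined at \<open>e\<close>. Otherwise the argument is that for the union with
  \<open>t\<close> and \<open>s\<close> exchanged.\<close>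

lemma gif_inter_assoc:
  assumes "cont_t_norm t" and "cont_t_conorm s"
    and "gif_soft_set U E A \<Phi>" and "gif_soft_set U E B \<Psi>" and "gif_soft_set U E C \<Theta>"
  shows "gif_inter t s U \<Phi> (gif_inter t s U \<Psi> \<Theta>) = gif_inter t s U (gif_inter t s U \<Phi> \<Psi>) \<Theta>"
proof
  fix e
  show "(gif_inter t s U \<Phi> (gif_inter t s U \<Psi> \<Theta>)) e = (gif_inter t s U (gif_inter t s U \<Phi> \<Psi>) \<Theta>) e"
    unfolding gif_inter_def
    by (auto split: option.split prod.split intro!: restrict_ext
          cont_t_norm_assoc[OF assms(1)]
          cont_t_conorm_assoc[OF assms(2)]
        dest:
          gif_soft_set_unit[OF assms(3)]
          gif_soft_set_unit[OF assms(4)]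
          gif_soft_set_unit[OF assms(5)])
qed

theorem theorem3p8:
  fixes t s :: "real \<Rightarrow> real \<Rightarrow> real"
    and U :: "'u set" and E A B C :: "'e set"
    and F\<^sub>\<alpha> G\<^sub>\<beta> H\<^sub>\<delta> :: "('u, 'e) gif_map"
  assumes "cont_t_norm t" and "cont_t_conorm s"
    and "gif_soft_set U E A F\<^sub>\<alpha>"
    and "gif_soft_set U E B G\<^sub>\<beta>"
    and "gif_soft_set U E C H\<^sub>\<delta>"
  shows "gif_union t s U F\<^sub>\<alpha> G\<^sub>\<beta> = gif_union t s U G\<^sub>\<beta> F\<^sub>\<alpha>
    \<and> gif_inter t s U F\<^sub>\<alpha> G\<^sub>\<beta> = gif_inter t s U G\<^sub>\<beta> F\<^sub>\<alpha>
    \<and> gif_union t s U F\<^sub>\<alpha> (gif_union t s U G\<^sub>\<beta> H\<^sub>\<delta>)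
        = gif_union t s U (gif_union t s U F\<^sub>\<alpha> G\<^sub>\<beta>) H\<^sub>\<delta>
    \<and> gif_inter t s U F\<^sub>\<alpha> (gif_inter t s U G\<^sub>\<beta> H\<^sub>\<delta>)
        = gif_inter t s U (gif_inter t s U F\<^sub>\<alpha> G\<^sub>\<beta>) H\<^sub>\<delta>"
  using assms
  by (intro conjI gif_union_comm gif_inter_comm gif_union_assoc gif_inter_assoc)

end
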